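(* Let $F:\mathbb{R}^m\to\mathbb{R}^m$ be a continuously differentiable mapping and assume that $\mathrm{Sol}(\mathbb{R}^m,F)\neq\emptyset$. Let $x_0\in S\subset\mathbb{R}^m$, where $S$ is a compact set that is positively invariant with respect to the dynamics $\dot x=-\nabla F(x)^\top F(x)$. Assume that $\lambda_{\min}(\nabla F(x)\nabla F(x)^\top)\neq 0$ for all $x\in S$ with $F(x)\neq 0$. Then any solution $x:[0,+\infty)\to\mathbb{R}^m$ of $\dot x=-\nabla F(x)^\top F(x)$ starting from $x(0)=x_0$ converges to the largest invariant set $M$ contained in $\mathrm{Sol}(\mathbb{R}^m,F)\cap S$, i.e., $\mathrm{dist}(x(t),M)\to 0$ as $t\to\infty$.
   Context: For $K\subseteq\mathbb{R}^m$ and $F:K\to\mathbb{R}^m$, $\mathrm{Sol}(K,F)=\{x^*\in K\mid \langle F(x^* ),x-x^*\rangle\ge 0\ \text{for all }x\in K\}$ is the solution set of the variational inequality VI$(K,F)$. $\nabla F(x)$ is the Jacobian matrix of $F$ at $x$; $\lambda_{\min}(A)$ is the smallest eigenvalue of a symmetric matrix $A$; $\mathrm{dist}(x,M)=\inf_{y\in M}\|x-y\|$ with the Euclidean norm. For a system $\dot x=f(x)$, a set $M$ is invariant if $x(0)\in M$ implies $x(t)\in M$ for all $t\in\mathbb{R}$, and positively invariant if $x(0)\in M$ implies $x(t)\in M$ for all $t\ge 0$. Standing assumption: the vector field of the system is continuous and the system has a unique solution (on $[0,+\infty)$) for every initial point. *)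

theory Defs
  imports "HOL-Analysis.Analysis"
begin

definition VI_Sol :: "('a::real_inner) set \<Rightarrow> ('a \<Rightarrow> 'a) \<Rightarrow> 'a set" where
  "VI_Sol K F = {x \<in> K. \<forall>y\<in>K. F x \<bullet> (y - x) \<ge> 0}"

definition continuously_differentiable :: "(real^'n \<Rightarrow> real^'m) \<Rightarrow> bool" where
  "continuously_differentiable F \<longleftrightarrow>
     F differentiable_on UNIV \<and> continuous_on UNIV (\<lambda>x. jacobian F (at x))"

definition eigenvalue :: "real^'n^'n \<Rightarrow> real \<Rightarrow> bool" where
  "eigenvalue A c \<longleftrightarrow> (\<exists>v. v \<noteq> 0 \<and> A *v v = c *\<^sub>R v)"

(* Only meaningful where a smallest real eigenvalue exists, in particular for symmetric A. *)
definition lambda_min :: "real^'n^'n \<Rightarrow> real" where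
  "lambda_min A = (LEAST c. eigenvalue A c)"

(* T is the time interval, {0..} or UNIV below; at the end point of {0..} the derivative is
   one-sided, and the values of x outside T are irrelevant. *)
definition solves_on :: "(('a::real_normed_vector) \<Rightarrow> 'a) \<Rightarrow> real set \<Rightarrow> (real \<Rightarrow> 'a) \<Rightarrow> bool" where
  "solves_on f T x \<longleftrightarrow> (\<forall>t\<in>T. (x has_vector_derivative f (x t)) (at t within T))"

definition well_posed :: "(('a::real_normed_vector) \<Rightarrow> 'a) \<Rightarrow> bool" where
  "well_posed f \<longleftrightarrow> continuous_on UNIV f \<and>
     (\<forall>p. (\<exists>x. solves_on f {0..} x \<and> x 0 = p) \<and>
          (\<forall>x y. solves_on f {0..} x \<and> solves_on f {0..} y \<and> x 0 = p \<and> y 0 = p \<longrightarrow>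
                 (\<forall>t\<ge>0. x t = y t)))"

definition positively_invariant :: "(('a::real_normed_vector) \<Rightarrow> 'a) \<Rightarrow> 'a set \<Rightarrow> bool" where
  "positively_invariant f M \<longleftrightarrow>
     (\<forall>x. solves_on f {0..} x \<and> x 0 \<in> M \<longrightarrow> (\<forall>t\<ge>0. x t \<in> M))"

(* Forward well-posedness gives neither existence nor uniqueness for t < 0.  Points of an
   invariant set are therefore required to lie on a solution defined for all real times
   (otherwise sets left in finite backward time would be invariant vacuously), and every
   such solution has to stay in the set. *)
definition invariant_set :: "(('a::real_normed_vector) \<Rightarrow> 'a) \<Rightarrow> 'a set \<Rightarrow> bool" where
  "invariant_set f M \<longleftrightarrow>
     (\<forall>p\<in>M. \<exists>x. solves_on f UNIV x \<and> x 0 = p) \<and>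
     (\<forall>x. solves_on f UNIV x \<and> x 0 \<in> M \<longrightarrow> (\<forall>t. x t \<in> M))"

definition largest_invariant_subset ::
    "(('a::real_normed_vector) \<Rightarrow> 'a) \<Rightarrow> 'a set \<Rightarrow> 'a set \<Rightarrow> bool" where
  "largest_invariant_subset f E M \<longleftrightarrow>
     M \<subseteq> E \<and> invariant_set f M \<and> (\<forall>N. N \<subseteq> E \<and> invariant_set f N \<longrightarrow> N \<subseteq> M)"

definition gradient_descent_field :: "(real^'n \<Rightarrow> real^'m) \<Rightarrow> real^'n \<Rightarrow> real^'n" where
  "gradient_descent_field F x = - (transpose (jacobian F (at x)) *v F x)"

(* infdist x {} = 0 by convention, so nonemptiness of M has to be stated separately. *)
definition converges_to_set :: "(real \<Rightarrow> 'a::metric_space) \<Rightarrow> 'a set \<Rightarrow> bool" where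
  "converges_to_set x M \<longleftrightarrow> M \<noteq> {} \<and> ((\<lambda>t. infdist (x t) M) \<longlongrightarrow> 0) at_top"

end

(* The squared residual V x = F x \<bullet> F x satisfies V' = - 2 |J^T F|^2 along solutions, J being the
   Jacobian.  On S the eigenvalue condition makes J^T F vanish only at zeros of F, so V is a strict
   Lyapunov function on the compact set S: it decreases at a uniform rate while V \<ge> \<epsilon>, hence
   tends to 0, and the solution approaches the zeros of F in S.

   These zeros already form an invariant set, although backward solutions need not be unique in
   general.  Since |J^T F| \<le> |J| |F|, Gronwall's inequality prevents V from reaching 0 in finite
   time, so the only two-sided solution through a zero of F is the constant one. *)

theory Submission
  imports Defs
begin

section \<open>Unconstrained variational inequalities and linear algebra of
  \<open>A ** transpose A\<close>\<close>

lemma VI_Sol_UNIV: "VI_Sol UNIV F = {x. F x = 0}"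
proof -
  have "F x = 0" if "\<forall>y. F x \<bullet> (y - x) \<ge> 0" for x
    \<comment> \<open>The test point \<open>x - F x\<close> turns the inequality into -|F x|^2 \<ge>
      0.\<close>
    using that[rule_format, of "x - F x"] by (simp add: dot_square_norm)
  then show ?thesis
    by (auto simp: VI_Sol_def)
qed

lemma inner_transpose_mult:
  fixes A :: "real^'n^'m"
  shows "(transpose A *v y) \<bullet> x = y \<bullet> (A *v x)"
  by (simp add: dot_lmul_matrix)

text \<open>\<open>norm A\<close> is the Frobenius norm (a matrix is a vector of rows):
  Cauchy-Schwarz in each row, then the root of the sum of squares.\<close>

lemma norm_matrix_vector_mult_le:
  fixes A :: "real^'n^'m"
  shows "norm (A *v x) \<le> norm A * norm x"
proof -
  have "norm (A *v x) \<le> L2_set (\<lambda>i. norm x * norm (A $ i)) UNIV"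
    unfolding norm_vec_def[of "A *v x"]
  proof (rule L2_set_mono)
    fix i
    have "(A *v x) $ i = (A $ i) \<bullet> x"
      by (simp add: matrix_vector_mult_def inner_vec_def)
    then show "norm ((A *v x) $ i) \<le> norm x * norm (A $ i)"
      using Cauchy_Schwarz_ineq2[of "A $ i" x] by (simp add: mult.commute)
  qed simp
  also have "\<dots> = norm A * norm x"
    by (simp add: norm_vec_def[of A] L2_set_right_distrib[symmetric] mult.commute)
  finally show ?thesis .
qed

text \<open>By duality: z = A^T y satisfies |z|^2 = y \<bullet> A z, so the bound for
  \<open>A\<close> applies and one factor |z| cancels.\<close>

lemma norm_transpose_mult_le:
  fixes A :: "real^'n^'m"
  shows "norm (transpose A *v y) \<le> norm A * norm y"
proof (cases "transpose A *v y = 0")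
  case False
  let ?z = "transpose A *v y"
  have "norm ?z * norm ?z = y \<bullet> (A *v ?z)"
    by (metis inner_transpose_mult norm_eq_sqrt_inner real_sqrt_mult_self abs_of_nonneg inner_ge_zero)
  also have "\<dots> \<le> norm y * norm (A *v ?z)"
    by (rule norm_cauchy_schwarz)
  also have "\<dots> \<le> norm y * (norm A * norm ?z)"
    by (intro mult_left_mono norm_matrix_vector_mult_le) simp
  finally have "norm ?z * norm ?z \<le> (norm A * norm y) * norm ?z"
    by (simp add: mult_ac)
  then show ?thesis
    using False by simp
qed simp

text \<open>A A^T is positive semidefinite, so 0 bounds its eigenvalues from below, and y is an
  eigenvector for 0. Read contrapositively, this turns the eigenvalue condition into J^T F \<noteq>
  0.\<close>

lemma lambda_min_gram_eq_0:
  fixes A :: "real^'n^'m"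
  assumes "transpose A *v y = 0" "y \<noteq> 0"
  shows "lambda_min (A ** transpose A) = 0"
  unfolding lambda_min_def
proof (rule Least_equality)
  show "eigenvalue (A ** transpose A) 0"
    unfolding eigenvalue_def using assms
    by (intro exI[of _ y]) (simp add: matrix_vector_mul_assoc[symmetric])
next
  fix c
  assume "eigenvalue (A ** transpose A) c"
  then obtain v where v: "v \<noteq> 0" "A *v (transpose A *v v) = c *\<^sub>R v"
    unfolding eigenvalue_def matrix_vector_mul_assoc[symmetric] by blast
  have "c * (v \<bullet> v) = v \<bullet> (A *v (transpose A *v v))"
    by (simp only: v(2) inner_scaleR_right)
  also have "\<dots> = (transpose A *v v) \<bullet> (transpose A *v v)"
    by (simp only: inner_transpose_mult)
  also have "\<dots> \<ge> 0"
    by simp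
  finally show "0 \<le> c"
    using v(1) by (simp add: zero_le_mult_iff dot_square_norm)
qed

section \<open>The squared residual along solutions\<close>

text \<open>The chain rule gives 2 F \<bullet> J g; moving J across the inner product leaves 2 (J^T
  F) \<bullet> g with g = -J^T F. The general \<open>T\<close> covers both half-line and two-sided
  solutions.\<close>

lemma residual_has_derivative:
  fixes F :: "real^'n \<Rightarrow> real^'m"
  assumes F: "F differentiable_on UNIV" and x: "solves_on (gradient_descent_field F) T x" and t: "t \<in> T"
  shows "((\<lambda>t. F (x t) \<bullet> F (x t)) has_real_derivative
           - 2 * (norm (gradient_descent_field F (x t)))\<^sup>2) (at t within T)"
proof -
  let ?g = "gradient_descent_field F (x t)" and ?J = "jacobian F (at (x t))"
  have "(x has_derivative (\<lambda>h. h *\<^sub>R ?g)) (at t within T)"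
    using x t by (auto simp: solves_on_def has_vector_derivative_def)
  moreover have "(F has_derivative (\<lambda>h. ?J *v h)) (at (x t))"
    using F by (simp add: differentiable_on_def jacobian_works)
  ultimately have "((\<lambda>t. F (x t)) has_derivative (\<lambda>h. ?J *v (h *\<^sub>R ?g))) (at t within T)"
    by (rule has_derivative_compose)
  then have "((\<lambda>t. F (x t) \<bullet> F (x t)) has_derivative
      (\<lambda>h. F (x t) \<bullet> (?J *v (h *\<^sub>R ?g)) + (?J *v (h *\<^sub>R ?g)) \<bullet> F (x t))) (at t within T)"
    by (intro has_derivative_inner)
  moreover have "F (x t) \<bullet> (?J *v (h *\<^sub>R ?g)) + (?J *v (h *\<^sub>R ?g)) \<bullet> F (x t)
      = (- 2 * (norm ?g)\<^sup>2) * h" for h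
  proof -
    have "F (x t) \<bullet> (?J *v (h *\<^sub>R ?g)) = (transpose ?J *v F (x t)) \<bullet> (h *\<^sub>R ?g)"
      by (simp only: inner_transpose_mult)
    also have "\<dots> = - h * (norm ?g)\<^sup>2"
      by (simp add: gradient_descent_field_def power2_norm_eq_inner)
    finally show ?thesis
      by (simp add: inner_commute)
  qed
  ultimately show ?thesis
    by (simp only: has_field_derivative_def)
qed

lemma two_sided_solution_through_zero:
  fixes F :: "real^'n \<Rightarrow> real^'m"
  assumes F: "continuously_differentiable F"
    and x: "solves_on (gradient_descent_field F) UNIV x" and x0: "F (x 0) = 0"
  shows "x t = x 0"
proof -
  let ?g = "gradient_descent_field F" and ?J = "\<lambda>t. jacobian F (at (x t))"
  let ?V = "\<lambda>t. F (x t) \<bullet> F (x t)"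
  have diff: "F differentiable_on UNIV"
    using F by (simp add: continuously_differentiable_def)
  have V': "(?V has_real_derivative - 2 * (norm (?g (x t)))\<^sup>2) (at t)" for t
    using residual_has_derivative[OF diff x, of t] by simp
  have contx: "continuous_on UNIV x"
    using x by (auto simp: solves_on_def continuous_on_eq_continuous_within
        intro: has_vector_derivative_continuous)
  have "F (x t) = 0" for t
  proof (cases "0 \<le> t")
    case True
    \<comment> \<open>Forward in time, V is nonincreasing and nonnegative, so it stays 0.\<close>
    have "?V t \<le> ?V 0"
    proof (rule DERIV_nonpos_imp_nonincreasing[where f = ?V, OF True])
      fix s
      show "\<exists>y. (?V has_real_derivative y) (at s) \<and> y \<le> 0"
        by (intro exI conjI, rule V') simp
    qed
    then show ?thesis
      using x0 by (simp add: dot_square_norm)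
  next
    case False
    have "continuous_on UNIV ?J"
      using F contx unfolding continuously_differentiable_def
      by (auto intro: continuous_on_compose2[where g = "\<lambda>p. jacobian F (at p)"])
    then have "continuous_on {t..0} ?J"
      by (rule continuous_on_subset) simp
    then have "compact (?J ` {t..0})"
      by (rule compact_continuous_image) (rule compact_Icc)
    then have "bounded (?J ` {t..0})"
      by (rule compact_imp_bounded)
    then obtain L where L: "norm (?J s) \<le> L" if "s \<in> {t..0}" for s
      unfolding bounded_iff ball_simps by blast
    \<comment> \<open>Gronwall backward in time: V' \<ge> -2 L^2 V, so the integrating factor makes
      \<open>?w\<close> nondecreasing, and V(t) > 0 would contradict
      \<open>?w 0 = 0\<close>.\<close>
    let ?w = "\<lambda>s. ?V s * exp (2 * L\<^sup>2 * s)"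
    have "?w t \<le> ?w 0"
    proof (rule DERIV_nonneg_imp_nondecreasing[where f = ?w])
      show "t \<le> 0" using False by simp
      fix s assume s: "t \<le> s" "s \<le> 0"
      have "((\<lambda>s. exp (2 * L\<^sup>2 * s)) has_real_derivative exp (2 * L\<^sup>2 * s) * (2 * L\<^sup>2)) (at s)"
        by (auto intro!: derivative_eq_intros)
      from DERIV_mult[OF V' this] have "(?w has_real_derivative
          (- 2 * (norm (?g (x s)))\<^sup>2) * exp (2 * L\<^sup>2 * s) + exp (2 * L\<^sup>2 * s) * (2 * L\<^sup>2) * ?V s) (at s)" .
      moreover have "(norm (?g (x s)))\<^sup>2 \<le> L\<^sup>2 * ?V s"
      proof -
        have "norm (?g (x s)) \<le> norm (?J s) * norm (F (x s))"
          unfolding gradient_descent_field_def norm_minus_cancel by (rule norm_transpose_mult_le)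
        also have "\<dots> \<le> L * norm (F (x s))"
          using L s by (intro mult_right_mono) auto
        finally have "(norm (?g (x s)))\<^sup>2 \<le> (L * norm (F (x s)))\<^sup>2"
          by (intro power_mono) auto
        then show ?thesis
          by (simp add: power_mult_distrib power2_norm_eq_inner)
      qed
      then have "0 \<le> 2 * exp (2 * L\<^sup>2 * s) * (L\<^sup>2 * ?V s - (norm (?g (x s)))\<^sup>2)"
        by simp
      ultimately show "\<exists>y. (?w has_real_derivative y) (at s) \<and> 0 \<le> y"
        by (intro exI conjI) (assumption, simp add: algebra_simps)
    qed
    then have "?V t \<le> 0"
      using x0 by (simp add: mult_le_0_iff not_le)
    then show ?thesis
      by (simp add: dot_square_norm)
  qed
  \<comment> \<open>With F zero along the whole orbit, the velocity vanishes.\<close>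
  then have "(x has_vector_derivative 0) (at t within UNIV)" for t
    using x by (simp add: solves_on_def gradient_descent_field_def)
  then show ?thesis
    by (metis convex_UNIV has_vector_derivative_zero_constant UNIV_I)
qed

section \<open>Strict Lyapunov functions on compact sets\<close>

text \<open>\<open>W\<close> is the dissipation rate. On the compact part of \<open>S\<close> where
  V \<ge> e it has a positive minimum, so V cannot stay there without becoming negative.\<close>

lemma strict_lyapunov_tendsto_0:
  fixes x :: "real \<Rightarrow> 'a::metric_space"
  assumes S: "compact S" and xS: "\<And>t. t \<ge> 0 \<Longrightarrow> x t \<in> S"
    and contV: "continuous_on S V" and contW: "continuous_on S W"
    and V0: "\<And>p. p \<in> S \<Longrightarrow> V p \<ge> (0::real)" and W0: "\<And>p. p \<in> S \<Longrightarrow> W p \<ge> (0::real)"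
    and zero: "\<And>p. p \<in> S \<Longrightarrow> W p = 0 \<Longrightarrow> V p = 0"
    and V': "\<And>t. t \<ge> 0 \<Longrightarrow> ((\<lambda>t. V (x t)) has_real_derivative - W (x t)) (at t within {0..})"
  shows "((\<lambda>t. V (x t)) \<longlongrightarrow> 0) at_top"
proof -
  \<comment> \<open>Applied with c = \<open>W q\<close> for linear decay and with c = 0 for
    monotonicity. The derivative at time 0 is only one-sided, hence the mean value argument on the
    open interval plus continuity.\<close>
  have decr: "V (x b) + c * b \<le> V (x a) + c * a"
    if "0 \<le> a" "a \<le> b" and c: "\<And>t. 0 \<le> t \<Longrightarrow> t < b \<Longrightarrow> c \<le> W (x t)" for a b c
  proof (rule DERIV_nonpos_imp_decreasing_open[OF \<open>a \<le> b\<close>])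
    have "continuous_on {0..} (\<lambda>t. V (x t))"
      using V' by (auto simp: continuous_on_eq_continuous_within intro: DERIV_continuous)
    then show "continuous_on {a..b} (\<lambda>t. V (x t) + c * t)"
      using that(1) by (intro continuous_intros) (auto elim: continuous_on_subset)
    fix t assume t: "a < t" "t < b"
    then have "at t within {0..} = at t"
      using that(1) by (intro at_within_interior) simp
    then have "((\<lambda>t. V (x t) + c * t) has_real_derivative - W (x t) + c) (at t)"
      using V'[of t] t that(1) by (auto intro!: derivative_eq_intros)
    then show "\<exists>y. ((\<lambda>t. V (x t) + c * t) has_real_derivative y) (at t) \<and> y \<le> 0"
      using c[of t] t that(1) by force
  qed
  show ?thesis
  proof (rule tendstoI)
    fix e :: real assume e: "e > 0"
    have "\<exists>t0\<ge>0. V (x t0) < e"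
    proof (rule ccontr)
      assume "\<not> ?thesis"
      then have Ve: "V (x t) \<ge> e" if "t \<ge> 0" for t
        using that by force
      let ?K = "S \<inter> V -` {e..}"
      have "compact ?K"
        using continuous_closedin_preimage[OF contV, of "{e..}"] S
        by (simp add: closedin_compact)
      moreover have "?K \<noteq> {}"
        using xS[of 0] Ve[of 0] by auto
      moreover have "continuous_on ?K W"
        by (rule continuous_on_subset[OF contW]) simp
      ultimately obtain q where q: "q \<in> ?K" "\<And>p. p \<in> ?K \<Longrightarrow> W q \<le> W p"
        using continuous_attains_inf[of ?K W] by blast
      have Wq: "W q > 0"
        using q(1) W0[of q] zero[of q] e by force
      \<comment> \<open>By this time, decay at rate \<open>W q\<close> has used up all of
        \<open>V (x 0)\<close>, forcing V \<le> 0 < e.\<close>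
      define b where "b = V (x 0) / W q"
      have "b \<ge> 0"
        using V0[of "x 0"] xS[of 0] Wq by (simp add: b_def)
      then have "V (x b) + W q * b \<le> V (x 0) + W q * 0"
        using q(2) xS Ve by (intro decr) auto
      then show False
        using Ve[OF \<open>b \<ge> 0\<close>] e Wq by (simp add: b_def)
    qed
    then obtain t0 where t0: "t0 \<ge> 0" "V (x t0) < e"
      by blast
    have "dist (V (x t)) 0 < e" if "t \<ge> t0" for t
      using decr[of t0 t 0] that t0 W0 V0[of "x t"] xS by simp
    then show "\<forall>\<^sub>F t in at_top. dist (V (x t)) 0 < e"
      by (auto simp: eventually_at_top_linorder)
  qed
qed

text \<open>On a nonempty compact subset of \<open>S\<close> avoiding the zeros, V has a positive
  minimum, so a path with V tending to 0 eventually stays out of it.\<close>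

lemma converges_to_zero_set:
  fixes x :: "real \<Rightarrow> 'a::metric_space" and V :: "'a \<Rightarrow> real"
  assumes S: "compact S" and xS: "\<And>t. t \<ge> 0 \<Longrightarrow> x t \<in> S"
    and contV: "continuous_on S V" and V0: "\<And>p. p \<in> S \<Longrightarrow> V p \<ge> 0"
    and lim: "((\<lambda>t. V (x t)) \<longlongrightarrow> 0) at_top"
  shows "converges_to_set x {p \<in> S. V p = 0}"
proof -
  let ?M = "{p \<in> S. V p = 0}"
  have leave: "\<forall>\<^sub>F t in at_top. x t \<notin> K" if K: "compact K" "K \<subseteq> S" "K \<inter> ?M = {}" for K
  proof (cases "K = {}")
    case False
    then obtain q where q: "q \<in> K" "\<And>p. p \<in> K \<Longrightarrow> V q \<le> V p"
      using continuous_attains_inf[of K V] continuous_on_subset[OF contV K(2)] K(1) by blast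
    have "V q > 0"
      using q(1) K V0[of q] by force
    then have "\<forall>\<^sub>F t in at_top. V (x t) < V q"
      using lim order_tendstoD(2) by blast
    then show ?thesis
      by eventually_elim (use q(2) in force)
  qed simp
  have inS: "\<forall>\<^sub>F t in at_top. x t \<in> S"
    by (rule eventually_mono[OF eventually_ge_at_top[of 0]]) (rule xS)
  \<comment> \<open>Without zeros, \<open>S\<close> itself would be such a compact set, yet the path
    never leaves it.\<close>
  have "?M \<noteq> {}"
  proof
    assume "?M = {}"
    then have "\<forall>\<^sub>F t in at_top. x t \<notin> S"
      by (intro leave S) auto
    with inS have "\<forall>\<^sub>F t::real in at_top. False"
      by eventually_elim simp
    then show False
      by simp
  qed
  moreover have "((\<lambda>t. infdist (x t) ?M) \<longlongrightarrow> 0) at_top"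
  proof (rule tendstoI)
    fix e :: real assume e: "e > 0"
    \<comment> \<open>Avoiding this compact set while staying in \<open>S\<close> means being within
      distance e of the zeros.\<close>
    let ?K = "S \<inter> (\<lambda>p. infdist p ?M) -` {e..}"
    have "compact ?K"
      using continuous_closedin_preimage[of S "\<lambda>p. infdist p ?M" "{e..}"] S
      by (simp add: closedin_compact continuous_on_infdist)
    moreover have "?K \<inter> ?M = {}"
      using e by auto
    ultimately have "\<forall>\<^sub>F t in at_top. x t \<notin> ?K"
      by (intro leave) auto
    with inS show "\<forall>\<^sub>F t in at_top. dist (infdist (x t) ?M) 0 < e"
      by eventually_elim (auto simp: infdist_nonneg)
  qed
  ultimately show ?thesis
    by (simp add: converges_to_set_def)
qed

theorem proposition1:
  fixes F :: "real^'m \<Rightarrow> real^'m" and S :: "(real^'m) set" and x0 :: "real^'m"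
  assumes "continuously_differentiable F"
    and "well_posed (gradient_descent_field F)"
    and "VI_Sol UNIV F \<noteq> {}"
    and "x0 \<in> S"
    and "compact S"
    and "positively_invariant (gradient_descent_field F) S"
    and "\<And>x. x \<in> S \<Longrightarrow> F x \<noteq> 0 \<Longrightarrow>
           lambda_min (jacobian F (at x) ** transpose (jacobian F (at x))) \<noteq> 0"
  shows "\<exists>M. largest_invariant_subset (gradient_descent_field F) (VI_Sol UNIV F \<inter> S) M \<and>
           (\<forall>x. solves_on (gradient_descent_field F) {0..} x \<and> x 0 = x0 \<longrightarrow> converges_to_set x M)"
proof (intro exI conjI allI impI)
  let ?g = "gradient_descent_field F" and ?M = "VI_Sol UNIV F \<inter> S"
  have M: "?M = {p \<in> S. F p \<bullet> F p = 0}"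
    by (auto simp: VI_Sol_UNIV)
  have diff: "F differentiable_on UNIV"
    using assms(1) by (simp add: continuously_differentiable_def)
  \<comment> \<open>The whole intersection is invariant, so its maximality is immediate. Zeros of F
    are equilibria, which supplies the required two-sided solutions.\<close>
  have "invariant_set ?g ?M"
    unfolding invariant_set_def
  proof (intro conjI ballI allI impI)
    fix p assume "p \<in> ?M"
    then have "solves_on ?g UNIV (\<lambda>_. p)"
      by (simp add: VI_Sol_UNIV solves_on_def gradient_descent_field_def)
    then show "\<exists>x. solves_on ?g UNIV x \<and> x 0 = p"
      by blast
  next
    fix x t assume x: "solves_on ?g UNIV x \<and> x 0 \<in> ?M"
    then have "x t = x 0"
      by (intro two_sided_solution_through_zero[OF assms(1)]) (auto simp: VI_Sol_UNIV)
    then show "x t \<in> ?M"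
      using x by simp
  qed
  then show "largest_invariant_subset ?g ?M ?M"
    by (simp add: largest_invariant_subset_def)

  fix x
  assume x: "solves_on ?g {0..} x \<and> x 0 = x0"
  then have xS: "x t \<in> S" if "t \<ge> 0" for t
    using assms(4,6) that unfolding positively_invariant_def by blast
  have contF: "continuous_on S F"
    using diff differentiable_imp_continuous_on continuous_on_subset by blast
  have contg: "continuous_on S ?g"
    using assms(2) continuous_on_subset unfolding well_posed_def by blast
  \<comment> \<open>Strictness of V: J^T F = 0 with F \<noteq> 0 would make the smallest eigenvalue
    of J J^T zero.\<close>
  have zero: "F p = 0" if "p \<in> S" "?g p = 0" for p
    using assms(7)[OF that(1)] lambda_min_gram_eq_0[of "jacobian F (at p)" "F p"] that(2)
    by (auto simp: gradient_descent_field_def)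
  have "((\<lambda>t. F (x t) \<bullet> F (x t)) \<longlongrightarrow> 0) at_top"
  proof (rule strict_lyapunov_tendsto_0[where V = "\<lambda>p. F p \<bullet> F p" and W = "\<lambda>p. 2 * (norm (?g p))\<^sup>2",
        OF assms(5)])
    show "((\<lambda>t. F (x t) \<bullet> F (x t)) has_real_derivative - (2 * (norm (?g (x t)))\<^sup>2)) (at t within {0..})"
      if "t \<ge> 0" for t
      using residual_has_derivative[OF diff, of "{0..}" x t] x that by simp
  qed (use xS zero in \<open>auto intro!: continuous_intros contF contg\<close>)
  then show "converges_to_set x ?M"
    unfolding M using assms(5) xS
    by (intro converges_to_zero_set) (auto intro!: continuous_intros contF)
qed

end
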